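(* Let $p$ be a prime and $k$ a positive integer. The number of $2\times 2$ matrices with entries in $\mathbb{Z}_{p^k}$ that are diagonalizable over $\mathbb{Z}_{p^k}$ is $$|\mathrm{Diag}_2(\mathbb{Z}_{p^k})| = p^k + \frac{p^{k+1}(p^2-1)(p^{3k}-1)}{2(p^3-1)}.$$
   Context: $\mathbb{Z}_{p^k}$ denotes the ring of integers modulo $p^k$. A matrix $A\in M_n(\mathbb{Z}_{p^k})$ is diagonalizable over $\mathbb{Z}_{p^k}$ if $A = PDP^{-1}$ for some invertible $P\in GL_n(\mathbb{Z}_{p^k})$ and some diagonal $D\in M_n(\mathbb{Z}_{p^k})$. $\mathrm{Diag}_n(\mathbb{Z}_{p^k})$ denotes the set of all $n\times n$ matrices over $\mathbb{Z}_{p^k}$ that are diagonalizable over $\mathbb{Z}_{p^k}$. *)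

theory Defs
  imports Complex_Main "Jordan_Normal_Form.Matrix" "Berlekamp_Zassenhaus.Finite_Field"
begin

(* similar_mat forces A and D to be square of the same dimension, and its witnesses P, Q
   satisfy P * Q = 1, Q * P = 1 and A = P * D * Q over the ring 'a. *)
definition diagonalizable_mat :: "'a :: comm_ring_1 mat \<Rightarrow> bool" where
  "diagonalizable_mat A \<longleftrightarrow> (\<exists>D. diagonal_mat D \<and> similar_mat A D)"

definition Diag :: "nat \<Rightarrow> 'a :: comm_ring_1 mat set" where
  "Diag n = {A \<in> carrier_mat n n. diagonalizable_mat A}"

end

theory Submission
  imports Defs
begin

text \<open>
  A diagonalizable matrix has the form \<open>a I + d E\<close> with \<open>E\<close> a rank-one idempotent. Writing \<open>d\<close> as a
  power of \<open>p\<close> times a unit, it becomes \<open>[[a, 0], [0, a]] + p^l [[0, b], [c, e]]\<close>, where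
  \<open>X^2 - e X - b c\<close> has two roots that differ by a unit. By Hensel's lemma the latter
  only depends on \<open>(b, c, e)\<close> modulo \<open>p\<close>, and conversely two such roots provide a basis of
  eigenvectors. There are \<open>(p^3 - p) / 2\<close> such triples modulo \<open>p\<close>; sorting the triples modulo
  \<open>p^k\<close> by the exponent \<open>l\<close> gives a geometric series with ratio \<open>p^3\<close>.
\<close>

section \<open>Triples that split modulo p, and Hensel lifting of their roots\<close>

text \<open>The numbers \<open>x\<close> and \<open>y\<close> are the eigenvalues of \<open>[[0, b], [c, e]]\<close> modulo \<open>p\<close>.\<close>

definition split_mod :: "int \<Rightarrow> int \<times> int \<times> int \<Rightarrow> bool" where
  "split_mod p = (\<lambda>(b, c, e). \<exists>x y. \<not> p dvd x - y \<and> [x + y = e] (mod p) \<and> [x * y = - (b * c)] (mod p))"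

text \<open>Residues are represented by integers, so that the moduli p and p^k can be compared
  without a type for each of them.\<close>

definition box :: "nat \<Rightarrow> (int \<times> int \<times> int) set" where
  "box n = {0..<int n} \<times> {0..<int n} \<times> {0..<int n}"

text \<open>The exponent \<open>l\<close> is unbounded: every \<open>l\<close> from \<open>k\<close>
  on yields the zero triple, which belongs to the scalar matrices.\<close>

definition diag_triples :: "nat \<Rightarrow> nat \<Rightarrow> (int \<times> int \<times> int) set" where
  "diag_triples p k = {(b, c, e) \<in> box (p ^ k). \<exists>l b' c' e'. split_mod (int p) (b', c', e') \<and>
     [b = int p ^ l * b'] (mod int p ^ k) \<and> [c = int p ^ l * c'] (mod int p ^ k) \<and>
     [e = int p ^ l * e'] (mod int p ^ k)}"

lemma finite_box [simp]: "finite (box n)"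
  by (simp add: box_def)

lemma split_modI:
  assumes "\<not> p dvd x - y" "[x + y = e] (mod p)" "[x * y = - (b * c)] (mod p)"
  shows "split_mod p (b, c, e)"
  using assms by (auto simp: split_mod_def)

lemma split_mod_cong:
  assumes "split_mod p (b, c, e)" "[b = b'] (mod p)" "[c = c'] (mod p)" "[e = e'] (mod p)"
  shows "split_mod p (b', c', e')"
proof -
  from assms(1) obtain x y where xy: "\<not> p dvd x - y" "[x + y = e] (mod p)" "[x * y = - (b * c)] (mod p)"
    by (auto simp: split_mod_def)
  have "[x + y = e'] (mod p)" using xy(2) assms(4) by (rule cong_trans)
  moreover have "[x * y = - (b' * c')] (mod p)"
    using xy(3) assms(2,3) by (meson cong_minus_minus_iff cong_mult cong_trans)
  ultimately show ?thesis using xy(1) by (auto simp: split_mod_def)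
qed

text \<open>Hensel's lemma for the pair of roots at once: moving \<open>x\<close> and
  \<open>y\<close> by opposite amounts keeps their sum exactly \<open>e\<close>, and as
  \<open>x - y\<close> is a unit modulo p, the product can be corrected by one more power of p in
  each step.\<close>

lemma split_mod_lift:
  assumes "prime p" "split_mod p (b, c, e)"
  shows "\<exists>x y. \<not> p dvd x - y \<and> x + y = e \<and> [x * y = - (b * c)] (mod p ^ Suc j)"
proof (induction j)
  case 0
  from assms(2) obtain x y where xy: "\<not> p dvd x - y" "[x + y = e] (mod p)" "[x * y = - (b * c)] (mod p)"
    by (auto simp: split_mod_def)
  \<comment> \<open>Replacing \<open>y\<close> by \<open>e - x\<close> turns the congruence for the
    sum into an equation.\<close>
  have y: "[e - x = y] (mod p)"
    using cong_diff[OF cong_sym[OF xy(2)] cong_refl[of x p]] by simp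
  have "[x * (e - x) = - (b * c)] (mod p)"
    using cong_mult[OF cong_refl[of x p] y] xy(3) by (rule cong_trans)
  moreover have "\<not> p dvd x - (e - x)"
    using xy(1) cong_diff[OF cong_refl[of x p] y] by (metis cong_dvd_iff)
  ultimately show ?case by (intro exI[of _ x] exI[of _ "e - x"]) auto
next
  case (Suc j)
  then obtain x y where xy: "\<not> p dvd x - y" "x + y = e" "[x * y = - (b * c)] (mod p ^ Suc j)"
    by blast
  then obtain q where q: "x * y + b * c = p ^ Suc j * q"
    by (auto simp: cong_iff_dvd_diff)
  have "coprime (x - y) p"
    using xy(1) assms(1) by (metis coprime_commute prime_imp_coprime)
  then obtain s where s: "[(x - y) * s = 1] (mod p)" using cong_solve_coprime_int by blast
  \<comment> \<open>After the shift by \<open>p ^ Suc j * t\<close>, the error divided by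
    \<open>p ^ Suc j\<close> is \<open>q - (x - y) * t - p ^ Suc j * t^2\<close>. This
    \<open>t\<close> makes it vanish modulo p.\<close>
  define t where "t = s * q"
  have "[(x - y) * s * q = 1 * q] (mod p)" using s by (intro cong_mult) auto
  then have "p dvd (x - y) * t - q" by (simp add: t_def cong_iff_dvd_diff mult.assoc)
  then obtain r where r: "(x - y) * t - q = p * r" by auto
  have eq: "(x + p ^ Suc j * t) * (y - p ^ Suc j * t) + b * c = p ^ Suc (Suc j) * (- r - p ^ j * t\<^sup>2)"
  proof -
    have "(x + p ^ Suc j * t) * (y - p ^ Suc j * t) + b * c
        = (x * y + b * c) - p ^ Suc j * ((x - y) * t) - (p ^ Suc j * t)\<^sup>2"
      by (simp add: algebra_simps power2_eq_square)
    also have "\<dots> = - (p ^ Suc j * ((x - y) * t - q)) - (p ^ Suc j * t)\<^sup>2"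
      unfolding q by (simp add: algebra_simps)
    also have "\<dots> = p ^ Suc (Suc j) * (- r - p ^ j * t\<^sup>2)"
      unfolding r by (simp add: algebra_simps power2_eq_square)
    finally show ?thesis .
  qed
  have "[(x + p ^ Suc j * t) * (y - p ^ Suc j * t) = - (b * c)] (mod p ^ Suc (Suc j))"
    using eq by (simp only: cong_iff_dvd_diff) simp
  moreover have "\<not> p dvd (x + p ^ Suc j * t) - (y - p ^ Suc j * t)"
  proof
    assume "p dvd (x + p ^ Suc j * t) - (y - p ^ Suc j * t)"
    then have "p dvd ((x + p ^ Suc j * t) - (y - p ^ Suc j * t)) - p * (p ^ j * t * 2)"
      by (rule dvd_diff) simp
    then show False using xy(1) by (simp add: algebra_simps)
  qed
  ultimately show ?case using xy(2)
    by (intro exI[of _ "x + p ^ Suc j * t"] exI[of _ "y - p ^ Suc j * t"]) auto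
qed

text \<open>Both roots would have sum and product zero modulo p, hence both be zero and coincide.
  This separates the exponent 0 from the positive exponents in the count.\<close>

lemma not_split_mod_multiple:
  assumes "prime p"
  shows "\<not> split_mod p (p * b, p * c, p * e)"
proof
  assume "split_mod p (p * b, p * c, p * e)"
  then obtain x y where xy: "\<not> p dvd x - y" "[x + y = p * e] (mod p)" "[x * y = - (p * b * (p * c))] (mod p)"
    by (auto simp: split_mod_def)
  have s: "p dvd x + y" using xy(2) by (simp add: cong_dvd_iff)
  have "p dvd x * y" using xy(3) by (simp add: cong_dvd_iff)
  then have "p dvd x \<or> p dvd y" using assms by (simp add: prime_dvd_mult_iff)
  then have "p dvd x" "p dvd y" using s by (auto simp: dvd_add_right_iff dvd_add_left_iff)
  then show False using xy(1) by simp
qed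

section \<open>Counting the split triples modulo p\<close>

lemma card_pairs_less: "card {(x, y). 0 \<le> x \<and> x < y \<and> y < int p} = p * (p - 1) div 2"
proof -
  have "{(x, y). 0 \<le> x \<and> x < y \<and> y < int p} = (\<lambda>(y, x). (int x, int y)) ` (SIGMA y:{..<p}. {..<y})"
  proof (intro equalityI subsetI; clarify)
    fix x y :: int
    assume "0 \<le> x" "x < y" "y < int p"
    then show "(x, y) \<in> (\<lambda>(y, x). (int x, int y)) ` (SIGMA y:{..<p}. {..<y})"
      by (intro image_eqI[of _ _ "(nat y, nat x)"]) auto
  qed auto
  also have "card \<dots> = card (SIGMA y:{..<p}. {..<y})"
    by (rule card_image) (auto simp: inj_on_def)
  also have "\<dots> = (\<Sum>y<p. y)" by simp
  also have "\<dots> = p * (p - 1) div 2"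
    using Sum_Ico_nat[of 0 p] by (simp add: atLeast0LessThan)
  finally show ?thesis .
qed

text \<open>A split triple amounts to \<open>b\<close>, \<open>c\<close> and roots
  \<open>x < y\<close> with \<open>x * y = - (b * c)\<close> modulo p. If \<open>b\<close> is
  nonzero, then \<open>b\<close>, \<open>x\<close>, \<open>y\<close> are free and determine
  \<open>c\<close>, which gives (p - 1) * p (p - 1) / 2 choices. If \<open>b = 0\<close>, the
  smaller root is 0 while \<open>c\<close> and \<open>y\<close> > 0 are free, which gives p (p -
  1).\<close>

lemma card_split_box_prime:
  assumes "prime p"
  shows "2 * int (card {t \<in> box p. split_mod (int p) t}) = int p ^ 3 - int p"
proof -
  let ?P = "int p"
  have P: "prime ?P" "?P > 1" using assms prime_gt_1_nat by auto
  \<comment> \<open>Ordering the two roots makes them a function of the triple.\<close>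
  define Q where "Q = {(b, c, x, y). 0 \<le> b \<and> b < ?P \<and> 0 \<le> c \<and> c < ?P \<and> 0 \<le> x \<and> x < y \<and> y < ?P
    \<and> [x * y = - (b * c)] (mod ?P)}"
  define T where "T = {(x, y). 0 \<le> x \<and> x < y \<and> y < ?P}"
  have finT: "finite T"
    by (rule finite_subset[of _ "{0..<?P} \<times> {0..<?P}"]) (auto simp: T_def)
  have small: "a = a'" if "[a = a'] (mod ?P)" "0 \<le> a" "a < ?P" "0 \<le> a'" "a' < ?P" for a a'
    using that cong_less_imp_eq_int by blast
  have bij: "bij_betw (\<lambda>(b, c, x, y). (b, c, (x + y) mod ?P)) Q {t \<in> box p. split_mod ?P t}"
    unfolding bij_betw_def
  proof
    show "inj_on (\<lambda>(b, c, x, y). (b, c, (x + y) mod ?P)) Q"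
    proof (rule inj_onI)
      fix q q'
      assume qq: "q \<in> Q" "q' \<in> Q"
        "(\<lambda>(b, c, x, y). (b, c, (x + y) mod ?P)) q = (\<lambda>(b, c, x, y). (b, c, (x + y) mod ?P)) q'"
      obtain b c x y b' c' x' y' where [simp]: "q = (b, c, x, y)" "q' = (b', c', x', y')"
        by (cases q, cases q') auto
      have h: "(b, c, x, y) \<in> Q" "(b', c', x', y') \<in> Q" "b = b'" "c = c'" "(x + y) mod ?P = (x' + y') mod ?P"
        using qq by auto
      have r: "0 \<le> x" "x < y" "y < ?P" "0 \<le> x'" "x' < y'" "y' < ?P" using h by (auto simp: Q_def)
      have s: "?P dvd x + y - (x' + y')" using h(5) by (simp add: mod_eq_dvd_iff)
      have "[x * y = x' * y'] (mod ?P)" using h unfolding Q_def by simp (metis cong_sym cong_trans)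
      then have pr: "?P dvd x * y - x' * y'" by (simp add: cong_iff_dvd_diff)
      \<comment> \<open>Evaluating the monic quadratic with roots \<open>x'\<close> and
        \<open>y'\<close> at \<open>x\<close>: it has the same coefficients modulo p as the one with
        roots \<open>x\<close> and \<open>y\<close>, so it vanishes there.\<close>
      have "(x - x') * (x - y') = x * (x + y - (x' + y')) - (x * y - x' * y')"
        by (simp add: algebra_simps)
      then have "?P dvd (x - x') * (x - y')" using s pr by simp
      then have "?P dvd x - x' \<or> ?P dvd x - y'" using P(1) by (simp add: prime_dvd_mult_iff)
      then show "q = q'"
      proof
        assume d: "?P dvd x - x'"
        then have x: "x = x'" using small[of x x'] r by (simp add: cong_iff_dvd_diff)
        then have "y = y'" using small[of y y'] r s by (simp add: cong_iff_dvd_diff)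
        with x h show ?thesis by simp
      next
        \<comment> \<open>Here the two pairs would be swapped, against \<open>x < y\<close> and
          \<open>x' < y'\<close>.\<close>
        assume d: "?P dvd x - y'"
        then have x: "x = y'" using small[of x y'] r by (simp add: cong_iff_dvd_diff)
        then have "y = x'" using small[of y x'] r s by (simp add: cong_iff_dvd_diff)
        with x r show ?thesis by simp
      qed
    qed
    show "(\<lambda>(b, c, x, y). (b, c, (x + y) mod ?P)) ` Q = {t \<in> box p. split_mod ?P t}"
    proof (intro equalityI subsetI)
      fix t assume "t \<in> (\<lambda>(b, c, x, y). (b, c, (x + y) mod ?P)) ` Q"
      then obtain b c x y where q: "(b, c, x, y) \<in> Q" and t: "t = (b, c, (x + y) mod ?P)" by auto
      have "\<not> [x = y] (mod ?P)" using small[of x y] q by (auto simp: Q_def)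
      then have "\<not> ?P dvd x - y" by (simp add: cong_iff_dvd_diff)
      moreover have "[x + y = (x + y) mod ?P] (mod ?P)" by (simp add: cong_def)
      ultimately have "split_mod ?P t"
        using q unfolding t by (intro split_modI[of _ x y]) (auto simp: Q_def)
      then show "t \<in> {t \<in> box p. split_mod ?P t}"
        using q P(2) unfolding t by (auto simp: Q_def box_def)
    next
      fix t assume t: "t \<in> {t \<in> box p. split_mod ?P t}"
      obtain b c e where [simp]: "t = (b, c, e)" by (cases t)
      from t obtain x y where xy: "\<not> ?P dvd x - y" "[x + y = e] (mod ?P)" "[x * y = - (b * c)] (mod ?P)"
        by (auto simp: split_mod_def)
      define u where "u = min (x mod ?P) (y mod ?P)"
      define v where "v = max (x mod ?P) (y mod ?P)"
      have ne: "x mod ?P \<noteq> y mod ?P" using xy(1) by (simp add: mod_eq_dvd_iff)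
      have "[u * v = x * y] (mod ?P)" "[u + v = x + y] (mod ?P)"
        by (auto simp: u_def v_def min_def max_def cong_def mod_simps algebra_simps)
      then have uv: "[u * v = - (b * c)] (mod ?P)" "[u + v = e] (mod ?P)"
        using xy cong_trans by blast+
      have "(u + v) mod ?P = e" using uv(2) t by (auto simp: cong_def box_def)
      moreover have "(b, c, u, v) \<in> Q" using t uv(1) ne P(2)
        by (auto simp: Q_def box_def u_def v_def min_def max_def)
      ultimately show "t \<in> (\<lambda>(b, c, x, y). (b, c, (x + y) mod ?P)) ` Q"
        by (force simp: image_iff)
    qed
  qed
  \<comment> \<open>A chosen inverse modulo p, so that \<open>c\<close> becomes a function of
    \<open>b\<close>, \<open>x\<close> and \<open>y\<close>.\<close>
  define recip where "recip b = (SOME s. [b * s = 1] (mod ?P))" for b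
  have recip: "[b * recip b = 1] (mod ?P)" if "0 < b" "b < ?P" for b
  proof -
    have "coprime b ?P" using that P(1)
      by (metis coprime_commute prime_imp_coprime zdvd_not_zless)
    then show ?thesis unfolding recip_def by (rule someI_ex[OF cong_solve_coprime_int])
  qed
  have Q0: "{q \<in> Q. fst q \<noteq> 0} = (\<lambda>(b, x, y). (b, (- (x * y) * recip b) mod ?P, x, y)) ` ({0<..<?P} \<times> T)"
  proof (intro equalityI subsetI)
    fix q assume q: "q \<in> {q \<in> Q. fst q \<noteq> 0}"
    then obtain b c x y where [simp]: "q = (b, c, x, y)" by (cases q) auto
    have b: "0 < b" "b < ?P" and c: "0 \<le> c" "c < ?P" and eq: "[x * y = - (b * c)] (mod ?P)"
      using q by (auto simp: Q_def)
    have "[- (x * y) = b * c] (mod ?P)" using eq by (metis cong_minus_minus_iff minus_minus)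
    then have "[- (x * y) * recip b = b * c * recip b] (mod ?P)" by (intro cong_mult) auto
    also have "b * c * recip b = c * (b * recip b)" by simp
    also have "[\<dots> = c * 1] (mod ?P)" using recip[OF b] by (intro cong_mult) auto
    finally have "(- (x * y) * recip b) mod ?P = c" using c by (simp add: cong_def)
    then show "q \<in> (\<lambda>(b, x, y). (b, (- (x * y) * recip b) mod ?P, x, y)) ` ({0<..<?P} \<times> T)"
      using q b by (auto simp: Q_def T_def image_iff)
  next
    fix q assume "q \<in> (\<lambda>(b, x, y). (b, (- (x * y) * recip b) mod ?P, x, y)) ` ({0<..<?P} \<times> T)"
    then obtain b x y where b: "0 < b" "b < ?P" and xy: "(x, y) \<in> T"
      and q: "q = (b, (- (x * y) * recip b) mod ?P, x, y)" by auto
    have "[- (b * ((- (x * y) * recip b) mod ?P)) = - (b * (- (x * y) * recip b))] (mod ?P)"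
      unfolding cong_minus_minus_iff by (intro cong_mult cong_refl) (simp add: cong_def)
    also have "- (b * (- (x * y) * recip b)) = x * y * (b * recip b)" by simp
    also have "[\<dots> = x * y * 1] (mod ?P)" using recip[OF b] by (intro cong_mult) auto
    finally have "[x * y = - (b * ((- (x * y) * recip b) mod ?P))] (mod ?P)" by (simp add: cong_sym)
    then show "q \<in> {q \<in> Q. fst q \<noteq> 0}" using b xy P(2) unfolding q by (auto simp: Q_def T_def)
  qed
  have card0: "card {q \<in> Q. fst q \<noteq> 0} = (p - 1) * card T"
    unfolding Q0 by (subst card_image) (auto simp: inj_on_def card_cartesian_product nat_diff_distrib)
  have Q1: "{q \<in> Q. fst q = 0} = (\<lambda>(c, y). (0, c, 0, y)) ` ({0..<?P} \<times> {0<..<?P})"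
  proof -
    \<comment> \<open>p divides one of the factors, and \<open>y\<close> lies strictly between 0 and
      p.\<close>
    have "x = 0" if "[x * y = 0] (mod ?P)" "0 \<le> x" "x < y" "y < ?P" for x y
    proof -
      have "?P dvd x * y" using that(1) by (simp add: cong_0_iff)
      then have "?P dvd x \<or> ?P dvd y" using P(1) by (simp add: prime_dvd_mult_iff)
      moreover have "\<not> ?P dvd y" using zdvd_not_zless[of y ?P] that by auto
      ultimately show ?thesis using zdvd_not_zless[of x ?P] that by (cases "x = 0") auto
    qed
    then show ?thesis by (auto simp: Q_def image_iff)
  qed
  have card1: "card {q \<in> Q. fst q = 0} = p * (p - 1)"
    unfolding Q1 by (subst card_image) (auto simp: inj_on_def card_cartesian_product nat_diff_distrib)
  have "finite {q \<in> Q. fst q \<noteq> 0}" "finite {q \<in> Q. fst q = 0}"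
    unfolding Q0 Q1 using finT by auto
  then have "card ({q \<in> Q. fst q \<noteq> 0} \<union> {q \<in> Q. fst q = 0}) = (p - 1) * card T + p * (p - 1)"
    unfolding card0[symmetric] card1[symmetric] by (rule card_Un_disjoint) auto
  also have "{q \<in> Q. fst q \<noteq> 0} \<union> {q \<in> Q. fst q = 0} = Q" by auto
  finally have cQ: "card Q = (p - 1) * card T + p * (p - 1)" .
  have "even (p * (p - 1))" by auto
  then have "2 * card T = p * (p - 1)" unfolding T_def card_pairs_less by simp
  then have two_Q: "2 * card Q = (p - 1) * (p * (p - 1)) + 2 * (p * (p - 1))" unfolding cQ by simp
  have "int (p - 1) = ?P - 1" using P(2) by (simp add: of_nat_diff)
  then have "2 * int (card Q) = (?P - 1) * (?P * (?P - 1)) + 2 * (?P * (?P - 1))"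
    using arg_cong[OF two_Q, of int] by simp
  then show ?thesis unfolding bij_betw_same_card[OF bij, symmetric]
    by (simp add: algebra_simps power3_eq_cube)
qed

section \<open>Sorting the triples modulo p^k by the exponent of p\<close>

text \<open>Division with remainder by p in each coordinate: splitting depends on the three
  remainders only, and the three quotients range freely over \<open>m\<close> values each.\<close>

lemma card_split_box:
  assumes "p > 0"
  shows "card {t \<in> box (p * m). split_mod (int p) t} = m ^ 3 * card {t \<in> box p. split_mod (int p) t}"
proof -
  let ?P = "int p"
  let ?f = "\<lambda>((b, c, e), (b', c', e')). (b' + ?P * b, c' + ?P * c, e' + ?P * e)"
  have iff: "split_mod ?P (b' + ?P * b, c' + ?P * c, e' + ?P * e) = split_mod ?P (b', c', e')" for b c e b' c' e'
    by (rule iffI; erule split_mod_cong; simp add: cong_def)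
  have md: "split_mod ?P (b mod ?P, c mod ?P, e mod ?P)" if "split_mod ?P (b, c, e)" for b c e
    by (rule split_mod_cong[OF that]) (simp_all add: cong_def)
  have lt: "b' + ?P * b < ?P * int m" if "b < int m" "b' < ?P" for b b'
  proof -
    have "?P * (b + 1) \<le> ?P * int m" using that by (intro mult_left_mono) auto
    then show ?thesis using that by (simp add: algebra_simps)
  qed
  have dlt: "x div ?P < int m" if "x < ?P * int m" for x
  proof (rule ccontr)
    assume "\<not> x div ?P < int m"
    then have "?P * int m \<le> ?P * (x div ?P)" by (intro mult_left_mono) auto
    also have "\<dots> \<le> x" using assms by (simp add: minus_mod_eq_mult_div[symmetric])
    finally show False using that by simp
  qed
  have "bij_betw ?f (box m \<times> {t \<in> box p. split_mod ?P t}) {t \<in> box (p * m). split_mod ?P t}"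
    by (rule bij_betw_byWitness[where f' = "\<lambda>(b, c, e). ((b div ?P, c div ?P, e div ?P), (b mod ?P, c mod ?P, e mod ?P))"])
      (use assms md in \<open>auto simp: box_def iff lt dlt pos_imp_zdiv_nonneg_iff\<close>)
  then have "card {t \<in> box (p * m). split_mod ?P t} = card (box m \<times> {t \<in> box p. split_mod ?P t})"
    by (simp add: bij_betw_same_card)
  then show ?thesis by (simp add: card_cartesian_product box_def power3_eq_cube)
qed

text \<open>For \<open>l = 0\<close> the triple itself splits modulo p. For \<open>l > 0\<close> all
  entries are divisible by p, and dividing by p lowers both \<open>l\<close> and the exponent of the
  modulus by one.\<close>

lemma diag_triples_Suc:
  assumes "p > 0"
  shows "diag_triples p (Suc k) = {t \<in> box (p * p ^ k). split_mod (int p) t} \<union>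
    (\<lambda>(b, c, e). (int p * b, int p * c, int p * e)) ` diag_triples p k"
  (is "_ = ?S \<union> ?f ` _")
proof (intro equalityI subsetI)
  let ?P = "int p"
  fix t assume t: "t \<in> diag_triples p (Suc k)"
  obtain b c e where [simp]: "t = (b, c, e)" by (cases t)
  from t obtain l b' c' e' where s: "split_mod ?P (b', c', e')"
    and h: "[b = ?P ^ l * b'] (mod ?P ^ Suc k)" "[c = ?P ^ l * c'] (mod ?P ^ Suc k)" "[e = ?P ^ l * e'] (mod ?P ^ Suc k)"
    and box: "(b, c, e) \<in> box (p * p ^ k)"
    by (auto simp: diag_triples_def)
  show "t \<in> ?S \<union> ?f ` diag_triples p k"
  proof (cases l)
    case 0
    have "[x = y] (mod ?P)" if "[y = ?P ^ l * x] (mod ?P ^ Suc k)" for x y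
      using cong_modulus_mult[of y x ?P "?P ^ k"] that 0 by (simp add: cong_sym)
    then have "split_mod ?P t" using split_mod_cong[OF s] h by simp
    then show ?thesis using box by simp
  next
    case (Suc l')
    have div: "\<exists>z. x = ?P * z \<and> [z = ?P ^ l' * y] (mod ?P ^ k) \<and> 0 \<le> z \<and> z < ?P ^ k"
      if "[x = ?P ^ l * y] (mod ?P ^ Suc k)" "0 \<le> x" "x < ?P * ?P ^ k" for x y
    proof -
      have "[x = ?P ^ l * y] (mod ?P)" using cong_modulus_mult[of x _ ?P "?P ^ k"] that(1) by simp
      then have "?P dvd x" by (simp add: Suc cong_dvd_iff)
      then obtain z where z: "x = ?P * z" by auto
      have "?P ^ Suc k dvd ?P * z - ?P ^ l * y" using that(1) z by (simp add: cong_iff_dvd_diff)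
      moreover have "?P * z - ?P ^ l * y = ?P * (z - ?P ^ l' * y)" by (simp add: Suc algebra_simps)
      ultimately have "?P ^ k dvd z - ?P ^ l' * y" using assms by simp
      then show ?thesis using that assms z by (auto simp: cong_iff_dvd_diff zero_le_mult_iff)
    qed
    obtain b0 c0 e0 where "b = ?P * b0 \<and> [b0 = ?P ^ l' * b'] (mod ?P ^ k) \<and> 0 \<le> b0 \<and> b0 < ?P ^ k"
      "c = ?P * c0 \<and> [c0 = ?P ^ l' * c'] (mod ?P ^ k) \<and> 0 \<le> c0 \<and> c0 < ?P ^ k"
      "e = ?P * e0 \<and> [e0 = ?P ^ l' * e'] (mod ?P ^ k) \<and> 0 \<le> e0 \<and> e0 < ?P ^ k"
      using div[OF h(1)] div[OF h(2)] div[OF h(3)] box by (auto simp: box_def)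
    then have "(b0, c0, e0) \<in> diag_triples p k" "t = ?f (b0, c0, e0)"
      using s by (auto simp: diag_triples_def box_def)
    then show ?thesis by blast
  qed
next
  let ?P = "int p"
  fix t assume "t \<in> ?S \<union> ?f ` diag_triples p k"
  then show "t \<in> diag_triples p (Suc k)"
  proof
    assume "t \<in> ?S"
    moreover obtain b c e where "t = (b, c, e)" by (cases t)
    ultimately show ?thesis
      unfolding diag_triples_def
      by (simp, intro exI[of _ 0] exI[of _ b] exI[of _ c] exI[of _ e]) simp
  next
    assume "t \<in> ?f ` diag_triples p k"
    then obtain b c e where t: "t = (?P * b, ?P * c, ?P * e)" and m: "(b, c, e) \<in> diag_triples p k" by auto
    from m obtain l b' c' e' where s: "split_mod ?P (b', c', e')"
      and h: "[b = ?P ^ l * b'] (mod ?P ^ k)" "[c = ?P ^ l * c'] (mod ?P ^ k)" "[e = ?P ^ l * e'] (mod ?P ^ k)"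
      and box: "(b, c, e) \<in> box (p ^ k)"
      by (auto simp: diag_triples_def)
    have mul: "[?P * x = ?P ^ Suc l * y] (mod ?P ^ Suc k)" if "[x = ?P ^ l * y] (mod ?P ^ k)" for x y
    proof -
      have "?P * ?P ^ k dvd ?P * (x - ?P ^ l * y)" using that by (intro mult_dvd_mono) (auto simp: cong_iff_dvd_diff)
      then show ?thesis by (simp add: cong_iff_dvd_diff algebra_simps)
    qed
    have "t \<in> box (p ^ Suc k)" using box assms unfolding t by (simp add: box_def)
    then show ?thesis using s mul[OF h(1)] mul[OF h(2)] mul[OF h(3)] unfolding diag_triples_def t by blast
  qed
qed

lemma finite_diag_triples [simp]: "finite (diag_triples p k)"
  by (rule finite_subset[of _ "box (p ^ k)"]) (auto simp: diag_triples_def)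

lemma split_mod_exists:
  assumes "prime p"
  shows "split_mod p (0, 0, 1)"
  unfolding split_mod_def using assms by (simp, intro exI[of _ 1] exI[of _ 0]) auto

text \<open>With N(k) the number of triples, N(0) = 1 and N(k + 1) = N(k) + p^(3k) (p^3 - p) / 2, a
  geometric series. Multiplying by 2 (p^3 - 1) keeps the closed form in the integers.\<close>

lemma card_diag_triples:
  assumes "prime p"
  shows "2 * (int p ^ 3 - 1) * int (card (diag_triples p k)) =
    2 * (int p ^ 3 - 1) + (int p ^ 3 - int p) * (int p ^ (3 * k) - 1)"
proof (induction k)
  case 0
  \<comment> \<open>Modulo 1 all congruences hold, so the zero triple belongs to the set as soon as
    some triple splits modulo p.\<close>
  have "diag_triples p 0 = {(0, 0, 0)}"
    using split_mod_exists[of "int p"] assms by (auto simp: diag_triples_def box_def)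
  then show ?case by simp
next
  case (Suc k)
  let ?P = "int p"
  let ?f = "\<lambda>(b, c, e). (?P * b, ?P * c, ?P * e)"
  let ?S = "{t \<in> box (p * p ^ k). split_mod ?P t}"
  have p: "p > 0" using assms prime_gt_0_nat by blast
  have "?S \<inter> ?f ` diag_triples p k = {}"
    using not_split_mod_multiple[of ?P] assms by auto
  then have "card (diag_triples p (Suc k)) = card ?S + card (?f ` diag_triples p k)"
    unfolding diag_triples_Suc[OF p] by (intro card_Un_disjoint) auto
  also have "card (?f ` diag_triples p k) = card (diag_triples p k)"
    using p by (intro card_image) (auto simp: inj_on_def)
  also have "card ?S = (p ^ k) ^ 3 * card {t \<in> box p. split_mod ?P t}"
    by (rule card_split_box[OF p])
  finally have "2 * (?P ^ 3 - 1) * int (card (diag_triples p (Suc k))) =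
    (?P ^ 3 - 1) * ?P ^ (3 * k) * (2 * int (card {t \<in> box p. split_mod ?P t})) + 2 * (?P ^ 3 - 1) * int (card (diag_triples p k))"
    by (simp add: algebra_simps power_mult[symmetric])
  also have "\<dots> = 2 * (?P ^ 3 - 1) + (?P ^ 3 - ?P) * (?P ^ (3 * Suc k) - 1)"
    unfolding Suc.IH card_split_box_prime[OF assms] by (simp add: algebra_simps power_add power3_eq_cube)
  finally show ?case .
qed

section \<open>Diagonalizable two-by-two matrices over a commutative ring\<close>

definition mat2 :: "'a \<Rightarrow> 'a \<Rightarrow> 'a \<Rightarrow> 'a \<Rightarrow> 'a mat" where
  "mat2 a b c d = mat 2 2 (\<lambda>(i, j). if i = 0 then (if j = 0 then a else b) else (if j = 0 then c else d))"

lemma mat2_carrier [simp]: "mat2 a b c d \<in> carrier_mat 2 2"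
  by (simp add: mat2_def)

lemma mat2_index [simp]:
  "mat2 a b c d $$ (0, 0) = a" "mat2 a b c d $$ (0, Suc 0) = b"
  "mat2 a b c d $$ (Suc 0, 0) = c" "mat2 a b c d $$ (Suc 0, Suc 0) = d"
  by (simp_all add: mat2_def)

lemma mat2_eq_iff [simp]: "mat2 a b c d = mat2 a' b' c' d' \<longleftrightarrow> a = a' \<and> b = b' \<and> c = c' \<and> d = d'"
  by (metis mat2_index)

lemma mat2_cases:
  assumes "A \<in> carrier_mat 2 2"
  obtains a b c d where "A = mat2 a b c d"
proof
  show "A = mat2 (A $$ (0, 0)) (A $$ (0, 1)) (A $$ (1, 0)) (A $$ (1, 1))"
    by (rule eq_matI) (use assms in \<open>auto simp: mat2_def less_2_cases_iff\<close>)
qed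

lemma mat2_mult:
  "mat2 a b c d * mat2 a' b' c' d' = mat2 (a * a' + b * c') (a * b' + b * d') (c * a' + d * c') (c * b' + d * d')"
  by (rule eq_matI) (auto simp: mat2_def scalar_prod_def less_2_cases_iff numeral_2_eq_2)

lemma one_mat2: "1\<^sub>m 2 = mat2 1 0 0 1"
  by (rule eq_matI) (auto simp: mat2_def less_2_cases_iff)

lemma diagonal_mat2_iff [simp]: "diagonal_mat (mat2 a b c d) \<longleftrightarrow> b = 0 \<and> c = 0"
  by (auto simp: diagonal_mat_def mat2_def less_2_cases_iff)

text \<open>With \<alpha> and \<beta> the diagonal entries of \<open>D\<close>, the matrix is
  \<alpha> I + (\<beta> - \<alpha>) E, where E is the second column of \<open>P\<close> times the
  second row of \<open>Q\<close>. The entries of E give \<open>b\<close>, \<open>c\<close>,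
  \<open>x\<close> and \<open>- y\<close>; trace 1 and determinant 0 of E become the two
  equations.\<close>

lemma Diag_2E:
  fixes A :: "'a :: comm_ring_1 mat"
  assumes "A \<in> Diag 2"
  obtains a d b c x y where "A = mat2 a (d * b) (d * c) (a + d * (x + y))"
    "x - y = 1" "x * y = - (b * c)"
proof -
  from assms obtain D P Q where A: "A \<in> carrier_mat 2 2" and D: "diagonal_mat D" and
    w: "similar_mat_wit A D P Q"
    by (auto simp: Diag_def diagonalizable_mat_def similar_mat_def)
  note w = similar_mat_witD2[OF A w]
  obtain \<alpha> \<beta> where D: "D = mat2 \<alpha> 0 0 \<beta>" using mat2_cases[OF w(5)] D by (metis diagonal_mat2_iff)
  obtain p q r s where P: "P = mat2 p q r s" using mat2_cases[OF w(6)] .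
  obtain p' q' r' s' where Q: "Q = mat2 p' q' r' s'" using mat2_cases[OF w(7)] .
  have e: "p * p' + q * r' = 1" "p * q' + q * s' = 0" "r * p' + s * r' = 0" "r * q' + s * s' = 1"
    "r' * q + s' * s = 1"
    using w(1,2) by (auto simp: P Q one_mat2 mat2_mult)
  have "A = mat2 (p * \<alpha> * p' + q * \<beta> * r') (p * \<alpha> * q' + q * \<beta> * s')
      (r * \<alpha> * p' + s * \<beta> * r') (r * \<alpha> * q' + s * \<beta> * s')"
    unfolding w(3) P Q D by (simp add: mat2_mult)
  also have "\<dots> = mat2 (\<alpha> + (\<beta> - \<alpha>) * (q * r')) ((\<beta> - \<alpha>) * (q * s')) ((\<beta> - \<alpha>) * (s * r'))
      (\<alpha> + (\<beta> - \<alpha>) * (q * r') + (\<beta> - \<alpha>) * (s * s' + - (q * r')))"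
  \<comment> \<open>In each entry, \<alpha> is collected in front of the corresponding entry of
    \<open>P * Q\<close>, which is 0 or 1.\<close>
  proof -
    have "p * \<alpha> * p' + q * \<beta> * r' = \<alpha> * (p * p' + q * r') + (\<beta> - \<alpha>) * (q * r')"
      "p * \<alpha> * q' + q * \<beta> * s' = \<alpha> * (p * q' + q * s') + (\<beta> - \<alpha>) * (q * s')"
      "r * \<alpha> * p' + s * \<beta> * r' = \<alpha> * (r * p' + s * r') + (\<beta> - \<alpha>) * (s * r')"
      "r * \<alpha> * q' + s * \<beta> * s' = \<alpha> * (r * q' + s * s') + (\<beta> - \<alpha>) * (s * s')"
      by (simp_all add: algebra_simps)
    then show ?thesis unfolding e by (simp add: algebra_simps)
  qed
  \<comment> \<open>The witnesses are \<open>x = s * s'\<close> and \<open>y = - (q * r')\<close>.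
    Their difference is the lower right entry of \<open>Q * P\<close>.\<close>
  finally show thesis
    by (rule that) (use e(5) in \<open>simp_all add: algebra_simps\<close>)
qed

lemma mat2_in_Diag_aux:
  fixes a b c d x y :: "'a :: comm_ring_1"
  assumes "x * y = - (b * c)" "x - y dvd 1" "x dvd 1"
  shows "mat2 a (d * b) (d * c) (a + d * (x + y)) \<in> Diag 2"
proof -
  from assms(2) obtain v where v: "1 = (x - y) * v" by blast
  from assms(3) obtain u where u: "1 = x * u" by blast
  \<comment> \<open>The inverse of \<open>x * (x - y)\<close>, which equals
    \<open>b * c + x * x\<close>.\<close>
  define w where "w = u * v"
  have w: "w * (b * c + x * x) = 1"
  proof -
    have bc: "b * c = - (x * y)" using assms(1) by simp
    have "w * (b * c + x * x) = (x * u) * ((x - y) * v)"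
      unfolding w_def bc by (simp add: algebra_simps)
    then show ?thesis by (simp flip: u v)
  qed
  \<comment> \<open>\<open>(b, x)\<close> and \<open>(- x, c)\<close> are eigenvectors of \<open>[[0, b], [c, x + y]]\<close> for \<open>x\<close> and \<open>y\<close>; their
    determinant is \<open>x * (x - y)\<close>.\<close>
  let ?P = "mat2 b (- x) x c" and ?Q = "mat2 (w * c) (w * x) (- (w * x)) (w * b)"
  let ?D = "mat2 (a + d * x) 0 0 (a + d * y)"
  have PQ: "?P * ?Q = 1\<^sub>m 2" unfolding mat2_mult one_mat2 mat2_eq_iff using w by (simp add: algebra_simps)
  have QP: "?Q * ?P = 1\<^sub>m 2" unfolding mat2_mult one_mat2 mat2_eq_iff using w by (simp add: algebra_simps)
  have eq: "mat2 a (d * b) (d * c) (a + d * (x + y)) = ?P * ?D * ?Q"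
  proof -
    have xy: "x * y + b * c = 0" using assms(1) by simp
    \<comment> \<open>Each entry is written as the desired one times
      \<open>w * (b * c + x * x)\<close>, which is 1, plus or minus a multiple of
      \<open>x * y + b * c\<close>, which is 0.\<close>
    have "b * (a + d * x) * (w * c) + x * (a + d * y) * (w * x) = a * (w * (b * c + x * x)) + d * w * x * (x * y + b * c)"
      "b * (a + d * x) * (w * x) - x * (a + d * y) * (w * b) = d * b * (w * (b * c + x * x)) - d * b * w * (x * y + b * c)"
      "x * (a + d * x) * (w * c) - c * (a + d * y) * (w * x) = d * c * (w * (b * c + x * x)) - d * c * w * (x * y + b * c)"
      "x * (a + d * x) * (w * x) + c * (a + d * y) * (w * b) = (a + d * (x + y)) * (w * (b * c + x * x)) - d * w * x * (x * y + b * c)"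
      by (simp_all add: algebra_simps)
    then show ?thesis unfolding w xy by (simp add: mat2_mult)
  qed
  have "similar_mat (mat2 a (d * b) (d * c) (a + d * (x + y))) ?D"
    by (rule similar_matI[OF _ PQ QP eq]) simp
  then show ?thesis unfolding Diag_def diagonalizable_mat_def
    by (intro CollectI conjI exI[of _ ?D]) auto
qed

text \<open>Swapping \<open>x\<close> and \<open>y\<close> keeps the matrix and changes
  \<open>x - y\<close> only by a sign, so either root may be the unit.\<close>

lemma mat2_in_Diag:
  fixes a b c d x y :: "'a :: comm_ring_1"
  assumes "x * y = - (b * c)" "x - y dvd 1" "x dvd 1 \<or> y dvd 1"
  shows "mat2 a (d * b) (d * c) (a + d * (x + y)) \<in> Diag 2"
  using assms mat2_in_Diag_aux[of x y b c a d] mat2_in_Diag_aux[of y x b c a d]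
  by (metis add.commute minus_diff_eq minus_dvd_iff mult.commute)

section \<open>Passage to the residue ring and the final count\<close>

lemma of_int_mod_ring_eq_iff:
  "(of_int x :: 'a :: nontriv mod_ring) = of_int y \<longleftrightarrow> [x = y] (mod int CARD('a))"
  unfolding cong_def by transfer simp

lemma of_int_mod_ring_surj:
  fixes r :: "'a :: nontriv mod_ring"
  obtains z where "r = of_int z"
  by (metis of_int_mod_ring_to_int_mod_ring of_int_of_int_mod_ring)

lemma of_int_mod_ring_dvd_1:
  assumes "coprime x (int CARD('a :: nontriv))"
  shows "(of_int x :: 'a mod_ring) dvd 1"
proof -
  obtain s where "[x * s = 1] (mod int CARD('a))" using cong_solve_coprime_int[OF assms] by blast
  then have "(of_int (x * s) :: 'a mod_ring) = of_int 1" by (simp only: of_int_mod_ring_eq_iff)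
  then show ?thesis by (metis dvd_triv_left of_int_1 of_int_mult)
qed

text \<open>From left to right, the factor \<open>d\<close> of \<open>Diag_2E\<close> is split into
  a power of p and an integer \<open>u\<close> prime to p, and \<open>u\<close> is absorbed into the
  triple and its roots. From right to left, the roots modulo p are lifted to roots modulo p^k, which
  produce eigenvectors by \<open>mat2_in_Diag\<close>.\<close>

lemma Diag_2_eq_image:
  assumes "prime p" "k > 0" "CARD('a :: nontriv) = p ^ k"
  shows "(Diag 2 :: 'a mod_ring mat set) =
    (\<lambda>(a, b, c, e). mat2 a (of_int b) (of_int c) (a + of_int e)) ` (UNIV \<times> diag_triples p k)"
  (is "_ = ?F ` _")
proof (intro equalityI subsetI)
  let ?P = "int p" and ?M = "int p ^ k"
  have eq: "(of_int x :: 'a mod_ring) = of_int y \<longleftrightarrow> [x = y] (mod ?M)" for x y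
    using assms(3) by (simp add: of_int_mod_ring_eq_iff)
  have P: "prime ?P" using assms(1) by simp
  have cong_p: "[x = y] (mod ?P)" if "[x = y] (mod ?M)" for x y
    using that by (rule cong_dvd_modulus) (use assms(2) in simp)
  fix A :: "'a mod_ring mat"
  assume "A \<in> Diag 2"
  then obtain a d b c x y where A: "A = mat2 a (d * b) (d * c) (a + d * (x + y))"
    and xy: "x - y = 1" "x * y = - (b * c)" by (rule Diag_2E)
  obtain b' c' x' y' d' where r: "b = of_int b'" "c = of_int c'" "x = of_int x'" "y = of_int y'" "d = of_int d'"
    using of_int_mod_ring_surj by metis
  obtain l u where d: "d = of_int (?P ^ l * u)" and u: "\<not> ?P dvd u"
  proof (cases "d' = 0")
    case True
    \<comment> \<open>p^k is zero in the ring, so \<open>l = k\<close> and \<open>u = 1\<close>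
      represent \<open>d = 0\<close>.\<close>
    then have "d = of_int (?P ^ k * 1)" using r by (simp only: eq) (simp add: cong_def)
    then show ?thesis using P by (intro that[of k 1]) auto
  next
    case False
    then obtain u where "d' = ?P ^ multiplicity ?P d' * u" "\<not> ?P dvd u"
      using P by (metis multiplicity_decompose' not_prime_unit)
    then show ?thesis using that r by metis
  qed
  have "[x' - y' = 1] (mod ?M)" using xy(1) r by (simp flip: eq)
  then have "\<not> ?P dvd x' - y'" using P cong_p by (metis cong_dvd_iff not_prime_unit)
  \<comment> \<open>The roots scaled by \<open>u\<close> stay distinct modulo p because p is
    prime.\<close>
  then have 1: "\<not> ?P dvd u * x' - u * y'"
    using u P by (metis prime_dvd_mult_iff right_diff_distrib)
  have "[x' * y' = - (b' * c')] (mod ?M)" using xy(2) r by (simp flip: eq)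
  then have "[u * u * (x' * y') = u * u * (- (b' * c'))] (mod ?P)" by (intro cong_mult cong_p) auto
  then have "[u * x' * (u * y') = - (u * b' * (u * c'))] (mod ?P)" by (simp add: ac_simps)
  with 1 have s: "split_mod ?P (u * b', u * c', u * x' + u * y')"
    by (intro split_modI[of _ "u * x'" "u * y'"]) auto
  define t where "t = ((?P ^ l * (u * b')) mod ?M, (?P ^ l * (u * c')) mod ?M, (?P ^ l * (u * x' + u * y')) mod ?M)"
  have "t \<in> diag_triples p k"
    using s P unfolding t_def diag_triples_def box_def
    by (simp add: prime_gt_0_nat[OF assms(1)],
      intro exI[of _ l] exI[of _ "u * b'"] exI[of _ "u * c'"] exI[of _ "u * x' + u * y'"])
      (simp add: cong_def)
  moreover have m: "(of_int (z mod ?M) :: 'a mod_ring) = of_int z" for z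
    by (simp add: eq cong_def)
  have "A = ?F (a, t)"
    unfolding A t_def by (simp add: m r(1-4) d algebra_simps)
  ultimately show "A \<in> ?F ` (UNIV \<times> diag_triples p k)" by blast
next
  let ?P = "int p" and ?M = "int p ^ k"
  have eq: "(of_int x :: 'a mod_ring) = of_int y \<longleftrightarrow> [x = y] (mod ?M)" for x y
    using assms(3) by (simp add: of_int_mod_ring_eq_iff)
  have P: "prime ?P" using assms(1) by simp
  have unit: "(of_int x :: 'a mod_ring) dvd 1" if "\<not> ?P dvd x" for x
  proof (rule of_int_mod_ring_dvd_1)
    have "coprime x ?P" using that P by (metis coprime_commute prime_imp_coprime)
    then show "coprime x (int CARD('a))" by (simp add: assms(3))
  qed
  fix A :: "'a mod_ring mat"
  assume "A \<in> ?F ` (UNIV \<times> diag_triples p k)"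
  then obtain a b c e where A: "A = mat2 a (of_int b) (of_int c) (a + of_int e)"
    and t: "(b, c, e) \<in> diag_triples p k" by auto
  from t obtain l b' c' e' where s: "split_mod ?P (b', c', e')"
      and h: "[b = ?P ^ l * b'] (mod ?M)" "[c = ?P ^ l * c'] (mod ?M)" "[e = ?P ^ l * e'] (mod ?M)"
    by (auto simp: diag_triples_def)
  obtain j where "k = Suc j" using assms(2) by (cases k) auto
  with split_mod_lift[OF P s, of j] obtain x y
    where xy: "\<not> ?P dvd x - y" "x + y = e'" "[x * y = - (b' * c')] (mod ?M)" by auto
  \<comment> \<open>Non-units are the multiples of p, so two roots with a unit difference cannot
    both be non-units.\<close>
  have "\<not> ?P dvd x \<or> \<not> ?P dvd y" using xy(1) by (auto intro: dvd_diff)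
  then have "(of_int x :: 'a mod_ring) dvd 1 \<or> (of_int y :: 'a mod_ring) dvd 1" using unit by blast
  moreover have "(of_int x - of_int y :: 'a mod_ring) dvd 1" using unit[OF xy(1)] by simp
  moreover have "(of_int x * of_int y :: 'a mod_ring) = - (of_int b' * of_int c')"
    using xy(3) by (simp flip: eq)
  ultimately have "mat2 a (of_int (?P ^ l) * of_int b') (of_int (?P ^ l) * of_int c')
      (a + of_int (?P ^ l) * (of_int x + of_int y)) \<in> (Diag 2 :: 'a mod_ring mat set)"
    by (intro mat2_in_Diag)
  moreover have "A = mat2 a (of_int (?P ^ l) * of_int b') (of_int (?P ^ l) * of_int c')
      (a + of_int (?P ^ l) * (of_int x + of_int y))"
    unfolding A using h[folded eq] xy(2)[symmetric] by simp
  ultimately show "A \<in> Diag 2" by simp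
qed

text \<open>The parametrization is injective: \<open>a\<close>, \<open>b\<close> and
  \<open>c\<close> are entries of the matrix, \<open>e\<close> is the difference of the diagonal
  entries, and the triples consist of reduced residues.\<close>

lemma card_Diag_2:
  assumes "prime p" "k > 0" "CARD('a :: nontriv) = p ^ k"
  shows "card (Diag 2 :: 'a mod_ring mat set) = p ^ k * card (diag_triples p k)"
proof -
  have eq: "(of_int x :: 'a mod_ring) = of_int y \<longleftrightarrow> x = y"
    if "0 \<le> x" "x < int p ^ k" "0 \<le> y" "y < int p ^ k" for x y
    using that assms(3) by (auto simp: of_int_mod_ring_eq_iff intro: cong_less_imp_eq_int)
  have "inj_on (\<lambda>(a :: 'a mod_ring, b, c, e). mat2 a (of_int b) (of_int c) (a + of_int e)) (UNIV \<times> diag_triples p k)"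
    by (rule inj_onI) (auto simp: diag_triples_def box_def eq)
  then show ?thesis unfolding Diag_2_eq_image[OF assms]
    by (simp add: card_image card_cartesian_product assms(3))
qed

theorem theorem4p1:
  fixes p k :: nat
  assumes "prime p" and "k > 0"
    and "CARD('a :: nontriv) = p ^ k"
  shows "real (card (Diag 2 :: 'a mod_ring mat set)) =
    real p ^ k + real p ^ (k + 1) * (real p ^ 2 - 1) * (real p ^ (3 * k) - 1) / (2 * (real p ^ 3 - 1))"
proof -
  let ?G = "real (card (diag_triples p k))"
  have "real p > 1" using assms(1) prime_gt_1_nat by simp
  then have nz: "real p ^ 3 - 1 \<noteq> 0" by (smt (verit) one_less_power zero_less_numeral)
  have "real_of_int (2 * (int p ^ 3 - 1) * int (card (diag_triples p k))) =
    real_of_int (2 * (int p ^ 3 - 1) + (int p ^ 3 - int p) * (int p ^ (3 * k) - 1))"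
    unfolding card_diag_triples[OF assms(1)] ..
  then have "2 * (real p ^ 3 - 1) * ?G = 2 * (real p ^ 3 - 1) + (real p ^ 3 - real p) * (real p ^ (3 * k) - 1)"
    by simp
  then have G: "?G = 1 + (real p ^ 3 - real p) * (real p ^ (3 * k) - 1) / (2 * (real p ^ 3 - 1))"
    using nz by (simp add: field_simps)
  \<comment> \<open>The factor p^k counts the choices of \<open>a\<close>; here it is merged with
    p^3 - p into the stated numerator.\<close>
  have "real p ^ k * (real p ^ 3 - real p) = real p ^ (k + 1) * (real p ^ 2 - 1)"
    by (simp add: algebra_simps power2_eq_square power3_eq_cube)
  then show ?thesis unfolding card_Diag_2[OF assms] by (simp add: G distrib_left mult.assoc[symmetric])
qed

end
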